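(* Let $\alpha,\beta>0$, $\delta>0$, $B_0>0$, and let $A,B$ be two geometric functionals defined on sufficiently regular sets $\Gamma$ in $\mathbb{R}^2$ (the admissible sets), with $B(\Gamma)>0$ and with the scaling properties $$A(\lambda\Gamma)=\lambda^{-\alpha}A(\Gamma)\quad\text{and}\quad B(\lambda\Gamma)=\lambda^{\beta}B(\Gamma)\qquad\text{for any }\lambda>0.$$ Consider the penalized problem of minimizing $F_\delta(\Gamma)=A(\Gamma)+\delta B(\Gamma)$ over all admissible sets $\Gamma$, and the constrained problem of minimizing $A(\Gamma)$ over all admissible sets $\Gamma$ with $B(\Gamma)=B_0$. (i) If $\widetilde{\Gamma}$ is a minimizer for the penalized problem, then there exists a rescaling factor $\widetilde{R}$ such that $\widetilde{R}\,\widetilde{\Gamma}$ is a minimizer for the constrained problem with the constraint $B(\Gamma)=B_0$. (ii) Vice versa, if $\overline{\Gamma}$ is a minimizer for the constrained problem, then there exists a rescaling factor $\overline{R}$ such that $\overline{R}\,\overline{\Gamma}$ is a minimizer for the penalized problem.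
   Context: For $\lambda>0$ and $\Gamma\subset\mathbb{R}^2$, $\lambda\Gamma$ denotes the rescaling (dilation) of $\Gamma$ by the factor $\lambda$. The class of "sufficiently regular" sets is deliberately not specified further. A minimizer of a problem is an admissible set at which the infimum is attained. The motivating example is: $\Gamma$ a regular planar network of $H^2$ curves (a connected finite union of regular $H^2$ curves whose end points meet in junctions), $A$ the elastic energy, i.e. the integral of the squared curvature with respect to arclength ($\alpha=1$), and $B$ the total length ($\beta=1$) or, if $\Gamma$ is a single Jordan curve, the enclosed area ($\beta=2$).
   Formalization: Part (ii) additionally assumes that the constrained minimizer has A > 0; without this it is false (e.g. straight segments with A = 0 and B the length), and when A ≤ 0 no rescaling is ever a penalized minimizer. *)

theory Defs
  imports "HOL-Analysis.Analysis"
begin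

definition dilate :: "real \<Rightarrow> (real^2) set \<Rightarrow> (real^2) set" where
  "dilate c \<Gamma> = (\<lambda>x. c *\<^sub>R x) ` \<Gamma>"

text \<open>
  In the following, \<open>Adm\<close> is the class of admissible (sufficiently regular) sets. Since
  \<open>A\<close> and \<open>B\<close> are total functions in HOL, their values outside \<open>Adm\<close> are meaningless, and
  minimality is only tested against members of \<open>Adm\<close>.
\<close>

definition penalized_minimizer ::
  "(real^2) set set \<Rightarrow> ((real^2) set \<Rightarrow> real) \<Rightarrow> ((real^2) set \<Rightarrow> real) \<Rightarrow> real \<Rightarrow> (real^2) set \<Rightarrow> bool"
where
  "penalized_minimizer Adm A B \<delta> \<Gamma> \<longleftrightarrow>
     is_arg_min (\<lambda>\<Gamma>'. A \<Gamma>' + \<delta> * B \<Gamma>') (\<lambda>\<Gamma>'. \<Gamma>' \<in> Adm) \<Gamma>"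

text \<open>
  A constrained minimizer may have \<open>A \<Gamma> \<le> 0\<close> (for the elastic energy, a straight segment).
  Then \<open>\<lambda> powr (-\<alpha>) * A \<Gamma> + \<delta> * \<lambda> powr \<beta> * B \<Gamma>\<close> is strictly increasing in \<open>\<lambda> > 0\<close>, so no rescaling
  of \<open>\<Gamma>\<close> minimizes the penalized problem. Passing from constrained to penalized minimizers
  therefore needs \<open>A \<Gamma> > 0\<close> at the constrained minimizer.
\<close>

definition constrained_minimizer ::
  "(real^2) set set \<Rightarrow> ((real^2) set \<Rightarrow> real) \<Rightarrow> ((real^2) set \<Rightarrow> real) \<Rightarrow> real \<Rightarrow> (real^2) set \<Rightarrow> bool"
where
  "constrained_minimizer Adm A B B\<^sub>0 \<Gamma> \<longleftrightarrow>
     is_arg_min A (\<lambda>\<Gamma>'. \<Gamma>' \<in> Adm \<and> B \<Gamma>' = B\<^sub>0) \<Gamma>"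

end

theory Submission
  imports Defs
begin

text \<open>
  Rescaling is a free parameter that moves every admissible set, in a unique way, to any
  prescribed value of \<open>B\<close>. Hence a minimizer of the penalized problem can be compared
  with rescaled competitors having its own value of \<open>B\<close>; among these the penalty is constant,
  and minimizing \<open>A\<close> on one level set of \<open>B\<close> is, by homogeneity, the same as minimizing it
  on any other. This gives the first implication.

  For the converse, every admissible set is \<open>t\<close> times a set on the level \<open>B = B\<^sub>0\<close>, and its
  penalized energy is therefore at least \<open>g t = t powr (-\<alpha>) * A \<Gamma> + \<delta> * t powr \<beta> * B\<^sub>0\<close>, where
  \<open>\<Gamma>\<close> is the constrained minimizer; equality holds for \<open>t\<close> times \<open>\<Gamma>\<close> itself. So it suffices to
  dilate \<open>\<Gamma>\<close> by a minimum point of \<open>g\<close> on the positive half-line. When \<open>A \<Gamma> > 0\<close> both terms of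
  \<open>g\<close> have positive coefficients and such a point exists
  (lemma \<open>ex_minimizer_neg_powr_plus_powr\<close>).
\<close>

lemma dilate_dilate: "dilate c (dilate d \<Gamma>) = dilate (c * d) \<Gamma>"
  unfolding dilate_def by (simp add: image_image)

lemma dilate_one [simp]: "dilate 1 \<Gamma> = \<Gamma>"
  unfolding dilate_def by simp

lemma dilate_inverse_dilate:
  assumes "c \<noteq> 0"
  shows "dilate (inverse c) (dilate c \<Gamma>) = \<Gamma>"
  using assms by (simp add: dilate_dilate)

lemma powr_minus_inverse:
  fixes c \<alpha> :: real
  assumes "c > 0"
  shows "inverse c powr (-\<alpha>) = c powr \<alpha>"
  using assms by (simp add: powr_minus inverse_powr)

text \<open>
  The critical point \<open>R\<close> balances the two terms: \<open>\<alpha> * a * R powr (-\<alpha>) = \<beta> * b * R powr \<beta>\<close>.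
  In the variable \<open>u = ln (c / R)\<close> both terms are exponentials, and the tangent line bound
  \<open>1 + x \<le> exp x\<close> is sharp for both at \<open>u = 0\<close>; the balance makes the linear parts cancel.
\<close>

lemma ex_minimizer_neg_powr_plus_powr:
  fixes a b \<alpha> \<beta> :: real
  assumes "\<alpha> > 0" and "\<beta> > 0" and "a > 0" and "b > 0"
  obtains R where "R > 0"
    and "\<And>c. c > 0 \<Longrightarrow> R powr (-\<alpha>) * a + R powr \<beta> * b \<le> c powr (-\<alpha>) * a + c powr \<beta> * b"
proof -
  define R where "R = (\<alpha> * a / (\<beta> * b)) powr (1 / (\<alpha> + \<beta>))"
  have R: "R > 0"
    using assms by (simp add: R_def)
  have "R powr (\<alpha> + \<beta>) = \<alpha> * a / (\<beta> * b)"
    using assms by (simp add: R_def powr_powr)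
  then have "R powr \<alpha> * R powr \<beta> * (\<beta> * b) = \<alpha> * a"
    using assms by (simp add: powr_add)
  then have balance: "\<alpha> * (R powr (-\<alpha>) * a) = \<beta> * (R powr \<beta> * b)"
    using R by (simp add: powr_minus field_simps)
  show ?thesis
  proof (rule that[OF R])
    fix c :: real
    assume c: "c > 0"
    define u where "u = ln c - ln R"
    have scale: "c powr p = R powr p * exp (p * u)" for p
      using c R by (simp add: u_def powr_def algebra_simps flip: exp_add)
    have "R powr (-\<alpha>) * a + R powr \<beta> * b
        = R powr (-\<alpha>) * a * (1 - \<alpha> * u) + R powr \<beta> * b * (1 + \<beta> * u)"
    proof -
      have "\<alpha> * (R powr (-\<alpha>) * a) * u = \<beta> * (R powr \<beta> * b) * u"
        using balance by (rule arg_cong)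
      then show ?thesis
        by (simp add: algebra_simps)
    qed
    also have "\<dots> \<le> R powr (-\<alpha>) * a * exp (-\<alpha> * u) + R powr \<beta> * b * exp (\<beta> * u)"
      using assms exp_ge_add_one_self[of "-\<alpha> * u"] exp_ge_add_one_self[of "\<beta> * u"]
      by (intro add_mono mult_left_mono) simp_all
    also have "\<dots> = c powr (-\<alpha>) * a + c powr \<beta> * b"
      by (simp add: scale mult_ac)
    finally show "R powr (-\<alpha>) * a + R powr \<beta> * b \<le> c powr (-\<alpha>) * a + c powr \<beta> * b" .
  qed
qed

lemma ex_powr_scaling:
  fixes x y \<beta> :: real
  assumes "\<beta> > 0" and "x > 0" and "y > 0"
  obtains c where "c > 0" and "c powr \<beta> * x = y"
proof
  show "(y / x) powr (1 / \<beta>) > 0" and "((y / x) powr (1 / \<beta>)) powr \<beta> * x = y"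
    using assms by (simp_all add: powr_powr)
qed

theorem lemma5p4:
  fixes Adm :: "(real^2) set set"
    and A B :: "(real^2) set \<Rightarrow> real"
    and \<alpha> \<beta> \<delta> B\<^sub>0 :: real
  assumes "\<alpha> > 0" and "\<beta> > 0" and "\<delta> > 0" and "B\<^sub>0 > 0"
    and "\<And>\<Gamma> c. \<Gamma> \<in> Adm \<Longrightarrow> c > 0 \<Longrightarrow> dilate c \<Gamma> \<in> Adm"
    and "\<And>\<Gamma>. \<Gamma> \<in> Adm \<Longrightarrow> B \<Gamma> > 0"
    and "\<And>\<Gamma> c. \<Gamma> \<in> Adm \<Longrightarrow> c > 0 \<Longrightarrow> A (dilate c \<Gamma>) = c powr (-\<alpha>) * A \<Gamma>"
    and "\<And>\<Gamma> c. \<Gamma> \<in> Adm \<Longrightarrow> c > 0 \<Longrightarrow> B (dilate c \<Gamma>) = c powr \<beta> * B \<Gamma>"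
  shows "(\<forall>\<Gamma>. penalized_minimizer Adm A B \<delta> \<Gamma> \<longrightarrow>
            (\<exists>R>0. constrained_minimizer Adm A B B\<^sub>0 (dilate R \<Gamma>))) \<and>
         (\<forall>\<Gamma>. constrained_minimizer Adm A B B\<^sub>0 \<Gamma> \<and> A \<Gamma> > 0 \<longrightarrow>
            (\<exists>R>0. penalized_minimizer Adm A B \<delta> (dilate R \<Gamma>)))"
proof (intro conjI allI impI)
  fix \<Gamma>
  assume "penalized_minimizer Adm A B \<delta> \<Gamma>"
  then have adm: "\<Gamma> \<in> Adm"
    and min: "\<And>\<Gamma>'. \<Gamma>' \<in> Adm \<Longrightarrow> A \<Gamma> + \<delta> * B \<Gamma> \<le> A \<Gamma>' + \<delta> * B \<Gamma>'"
    by (auto simp: penalized_minimizer_def is_arg_min_linorder)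
  obtain R where R: "R > 0" and level: "R powr \<beta> * B \<Gamma> = B\<^sub>0"
    using ex_powr_scaling[OF \<open>\<beta> > 0\<close> assms(6)[OF adm] \<open>B\<^sub>0 > 0\<close>] by blast
  have "A (dilate R \<Gamma>) \<le> A \<Gamma>'" if adm': "\<Gamma>' \<in> Adm" and "B \<Gamma>' = B\<^sub>0" for \<Gamma>'
  proof -
    \<comment> \<open>Undoing the dilation brings the competitor to the level of \<open>\<Gamma>\<close>, where the penalties cancel.\<close>
    let ?\<Delta> = "dilate (inverse R) \<Gamma>'"
    have \<Delta>: "?\<Delta> \<in> Adm" and inv: "inverse R > 0"
      using assms(5)[OF adm'] R by simp_all
    have "B ?\<Delta> = B \<Gamma>"
      using assms(8)[OF adm' inv] R level[symmetric] \<open>B \<Gamma>' = B\<^sub>0\<close>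
      by (simp add: inverse_powr)
    then have "A \<Gamma> \<le> R powr \<alpha> * A \<Gamma>'"
      using min[OF \<Delta>] assms(7)[OF adm' inv] powr_minus_inverse[OF R] by simp
    then have "A \<Gamma> / R powr \<alpha> \<le> A \<Gamma>'"
      using R by (simp add: pos_divide_le_eq mult.commute)
    then show ?thesis
      using assms(7)[OF adm R] by (simp add: powr_minus_divide)
  qed
  moreover have "dilate R \<Gamma> \<in> Adm" and "B (dilate R \<Gamma>) = B\<^sub>0"
    using assms(5)[OF adm R] assms(8)[OF adm R] level by simp_all
  ultimately show "\<exists>R>0. constrained_minimizer Adm A B B\<^sub>0 (dilate R \<Gamma>)"
    using R by (auto simp: constrained_minimizer_def is_arg_min_linorder)
next
  fix \<Gamma>
  assume "constrained_minimizer Adm A B B\<^sub>0 \<Gamma> \<and> A \<Gamma> > 0"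
  then have adm: "\<Gamma> \<in> Adm" and B: "B \<Gamma> = B\<^sub>0" and pos: "A \<Gamma> > 0"
    and min: "\<And>\<Gamma>'. \<Gamma>' \<in> Adm \<Longrightarrow> B \<Gamma>' = B\<^sub>0 \<Longrightarrow> A \<Gamma> \<le> A \<Gamma>'"
    by (auto simp: constrained_minimizer_def is_arg_min_linorder)
  have "\<delta> * B\<^sub>0 > 0"
    using \<open>\<delta> > 0\<close> \<open>B\<^sub>0 > 0\<close> by simp
  then obtain R where R: "R > 0"
    and opt: "\<And>t. t > 0 \<Longrightarrow>
      R powr (-\<alpha>) * A \<Gamma> + R powr \<beta> * (\<delta> * B\<^sub>0) \<le> t powr (-\<alpha>) * A \<Gamma> + t powr \<beta> * (\<delta> * B\<^sub>0)"
    using ex_minimizer_neg_powr_plus_powr[OF \<open>\<alpha> > 0\<close> \<open>\<beta> > 0\<close> pos] by blast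
  have "A (dilate R \<Gamma>) + \<delta> * B (dilate R \<Gamma>) \<le> A \<Gamma>' + \<delta> * B \<Gamma>'" if adm': "\<Gamma>' \<in> Adm" for \<Gamma>'
  proof -
    obtain s where s: "s > 0" and "s powr \<beta> * B \<Gamma>' = B\<^sub>0"
      using ex_powr_scaling[OF \<open>\<beta> > 0\<close> assms(6)[OF adm'] \<open>B\<^sub>0 > 0\<close>] by blast
    define \<Delta> where "\<Delta> = dilate s \<Gamma>'"
    define t where "t = inverse s"
    have t: "t > 0" and \<Gamma>': "\<Gamma>' = dilate t \<Delta>"
      using s by (simp_all add: t_def \<Delta>_def dilate_inverse_dilate)
    have \<Delta>: "\<Delta> \<in> Adm" and B\<Delta>: "B \<Delta> = B\<^sub>0"
      using assms(5)[OF adm' s] assms(8)[OF adm' s] \<open>s powr \<beta> * B \<Gamma>' = B\<^sub>0\<close>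
      by (simp_all add: \<Delta>_def)
    have "A (dilate R \<Gamma>) + \<delta> * B (dilate R \<Gamma>) = R powr (-\<alpha>) * A \<Gamma> + R powr \<beta> * (\<delta> * B\<^sub>0)"
      using assms(7)[OF adm R] assms(8)[OF adm R] B by simp
    also have "\<dots> \<le> t powr (-\<alpha>) * A \<Gamma> + t powr \<beta> * (\<delta> * B\<^sub>0)"
      using opt[OF t] .
    also have "\<dots> \<le> t powr (-\<alpha>) * A \<Delta> + t powr \<beta> * (\<delta> * B\<^sub>0)"
      using min[OF \<Delta> B\<Delta>] by (simp add: mult_left_mono)
    also have "\<dots> = A \<Gamma>' + \<delta> * B \<Gamma>'"
      using assms(7)[OF \<Delta> t] assms(8)[OF \<Delta> t] B\<Delta> \<Gamma>' by simp
    finally show ?thesis .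
  qed
  moreover have "dilate R \<Gamma> \<in> Adm"
    using assms(5)[OF adm R] .
  ultimately show "\<exists>R>0. penalized_minimizer Adm A B \<delta> (dilate R \<Gamma>)"
    using R by (auto simp: penalized_minimizer_def is_arg_min_linorder)
qed

end
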